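(* Suppose a symmetric $(v,k,\lambda)$-BIBD admits a $0$-ULSE $\ell$-colouring. Then $\lambda=\frac{k((\ell-1)^2-k)}{(\ell-1)^2}$, and for each colour, the number $\gamma$ of blocks that contain no point of that colour equals $\frac{v}{\ell}$.
   Context: For positive integers $v,k,\lambda$ with $2\le k<v$, a $(v,k,\lambda)$-BIBD is a pair $(V,\mathcal{B})$ where $V$ is a set of $v$ points and $\mathcal{B}$ is a collection of $k$-element subsets of $V$ (blocks) such that every pair of distinct points lies in exactly $\lambda$ blocks. It is symmetric if the number of blocks equals $v$ (equivalently, $\lambda(v-1)=k(k-1)$). An $\ell$-colouring is a surjective map from $V$ onto a set of $\ell$ colours. A $0$-ULSE $\ell$-colouring is an $\ell$-colouring such that $(\ell-1)$ divides $k$ and in every block exactly one colour does not appear, while each of the other $\ell-1$ colours appears exactly $\frac{k}{\ell-1}$ times in that block. *)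

theory Defs
  imports Complex_Main "HOL-Library.Multiset"
begin

text \<open>
  Blocks form a multiset, so that repeated blocks are permitted and all counts of blocks
  are taken with multiplicity.
\<close>

definition bibd :: "'a set \<Rightarrow> 'a set multiset \<Rightarrow> nat \<Rightarrow> nat \<Rightarrow> nat \<Rightarrow> bool" where
  "bibd V \<B> v k lam \<longleftrightarrow>
     2 \<le> k \<and> k < v \<and> 0 < lam \<and>
     finite V \<and> card V = v \<and>
     (\<forall>b\<in>#\<B>. b \<subseteq> V \<and> card b = k) \<and>
     (\<forall>x\<in>V. \<forall>y\<in>V. x \<noteq> y \<longrightarrow> size {#b \<in># \<B>. x \<in> b \<and> y \<in> b#} = lam)"

definition symmetric_bibd :: "'a set \<Rightarrow> 'a set multiset \<Rightarrow> nat \<Rightarrow> nat \<Rightarrow> nat \<Rightarrow> bool" where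
  "symmetric_bibd V \<B> v k lam \<longleftrightarrow> bibd V \<B> v k lam \<and> size \<B> = v"

definition colouring :: "'a set \<Rightarrow> 'c set \<Rightarrow> nat \<Rightarrow> ('a \<Rightarrow> 'c) \<Rightarrow> bool" where
  "colouring V C l f \<longleftrightarrow> finite C \<and> card C = l \<and> f ` V = C"

text \<open>
  The truncated subtraction \<open>l - 1\<close> is harmless: if \<open>V\<close> is nonempty then \<open>l > 0\<close>, and for
  \<open>l = 1\<close> the divisibility condition forces \<open>k = 0\<close>, which no BIBD satisfies.
\<close>

definition zero_ULSE_colouring ::
  "'a set \<Rightarrow> 'a set multiset \<Rightarrow> nat \<Rightarrow> 'c set \<Rightarrow> nat \<Rightarrow> ('a \<Rightarrow> 'c) \<Rightarrow> bool" where
  "zero_ULSE_colouring V \<B> k C l f \<longleftrightarrow>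
     colouring V C l f \<and> (l - 1) dvd k \<and>
     (\<forall>b\<in>#\<B>.
        (\<exists>!c. c \<in> C \<and> c \<notin> f ` b) \<and>
        (\<forall>c\<in>C. c \<in> f ` b \<longrightarrow> card {x \<in> b. f x = c} = k div (l - 1)))"

end

theory Submission
  imports Defs
begin

text \<open>
  Let \<open>m = k / (l - 1)\<close> and let a colour class have \<open>n\<close> points and be met by \<open>w\<close> blocks, each
  in \<open>m\<close> points. In a symmetric design every point lies on \<open>k\<close> blocks, so counting flags and
  ordered pairs inside the class gives \<open>n k = w m\<close> and \<open>n (n - 1) \<lambda> + n k = w m\<^sup>2\<close>. Hence
  \<open>(n - 1) \<lambda> = k (m - 1)\<close>, so all classes have the same size \<open>n = v / l\<close>, and the class is
  missed by \<open>v - (l - 1) n = n\<close> blocks. Eliminating \<open>v\<close> with \<open>\<lambda> (v - 1) = k (k - 1)\<close> yields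
  \<open>\<lambda> = k - m\<^sup>2\<close>.
\<close>

text \<open>Double counting of the incidences \<open>P x b\<close>, with blocks taken with
  multiplicity. Every count of flags or pairs below is an instance.\<close>

lemma sum_size_filter_mset_swap:
  assumes "finite A"
  shows "(\<Sum>x\<in>A. size {#b \<in># M. P x b#}) = (\<Sum>b\<in>#M. card {x \<in> A. P x b})"
proof (induction M)
  case (add b M)
  have "(\<Sum>x\<in>A. size {#b' \<in># add_mset b M. P x b'#})
      = (\<Sum>x\<in>A. (if P x b then 1 else 0) + size {#b' \<in># M. P x b'#})"
    by (intro sum.cong) auto
  also have "\<dots> = card {x \<in> A. P x b} + (\<Sum>x\<in>A. size {#b' \<in># M. P x b'#})"
    using assms by (simp add: sum.distrib sum.If_cases Int_def)
  finally show ?case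
    using add.IH by simp
qed simp

lemma sum_mset_if_const:
  "(\<Sum>b\<in>#M. if P b then c else 0) = size {#b \<in># M. P b#} * (c :: nat)"
  by (induction M) auto

text \<open>Count the incidences of blocks through \<open>x\<close> with points \<open>y\<close>
  other than \<open>x\<close> that they contain: each such \<open>y\<close> accounts for
  \<open>lam\<close> of them, each block through \<open>x\<close> for \<open>k - 1\<close>.\<close>

lemma bibd_replication:
  assumes "bibd V \<B> v k lam" "x \<in> V"
  shows "size {#b \<in># \<B>. x \<in> b#} * (k - 1) = lam * (v - 1)"
proof -
  have fin: "finite V" and blk: "\<And>b. b \<in># \<B> \<Longrightarrow> b \<subseteq> V \<and> card b = k"
    and pair: "\<And>y. y \<in> V \<Longrightarrow> x \<noteq> y \<Longrightarrow> size {#b \<in># \<B>. x \<in> b \<and> y \<in> b#} = lam"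
    and "card V = v"
    using assms unfolding bibd_def by auto
  have "lam * (v - 1) = (\<Sum>y\<in>V - {x}. lam)"
    using \<open>card V = v\<close> assms(2) by (simp add: card_Diff_singleton)
  also have "\<dots> = (\<Sum>y\<in>V - {x}. size {#b \<in># \<B>. x \<in> b \<and> y \<in> b#})"
    by (rule sum.cong[OF refl], rule pair[symmetric]) blast+
  also have "\<dots> = (\<Sum>b\<in>#\<B>. card {y \<in> V - {x}. x \<in> b \<and> y \<in> b})"
    using fin by (intro sum_size_filter_mset_swap) simp
  also have "\<dots> = (\<Sum>b\<in>#\<B>. if x \<in> b then k - 1 else 0)"
  proof (intro arg_cong[where f = sum_mset] image_mset_cong)
    fix b assume "b \<in># \<B>"
    then have "b \<subseteq> V" "card b = k" using blk by auto
    moreover have "{y \<in> V - {x}. x \<in> b \<and> y \<in> b} = (if x \<in> b then b - {x} else {})"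
      using \<open>b \<subseteq> V\<close> by auto
    ultimately show "card {y \<in> V - {x}. x \<in> b \<and> y \<in> b} = (if x \<in> b then k - 1 else 0)"
      by (simp add: card_Diff_singleton)
  qed
  finally show ?thesis by (simp add: sum_mset_if_const)
qed

text \<open>As \<open>k - 1\<close> is positive, \<open>bibd_replication\<close> forces the same
  replication number at every point. Counting all flags then gives \<open>v\<close> times this
  number on one side and \<open>v * k\<close> on the other, because there are \<open>v\<close>
  blocks.\<close>

lemma symmetric_bibd_replication:
  assumes "symmetric_bibd V \<B> v k lam" "x \<in> V"
  shows "size {#b \<in># \<B>. x \<in> b#} = k"
proof -
  let ?r = "\<lambda>x. size {#b \<in># \<B>. x \<in> b#}"
  have bibd: "bibd V \<B> v k lam" and "size \<B> = v"
    using assms(1) unfolding symmetric_bibd_def by auto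
  then have fin: "finite V" and blk: "\<And>b. b \<in># \<B> \<Longrightarrow> b \<subseteq> V \<and> card b = k"
    and "card V = v" and "2 \<le> k" "k < v"
    unfolding bibd_def by auto
  have const: "?r y = ?r x" if "y \<in> V" for y
  proof -
    have "?r y * (k - 1) = ?r x * (k - 1)"
      using bibd_replication[OF bibd] that assms(2) by simp
    then show ?thesis using \<open>2 \<le> k\<close> by simp
  qed
  have "v * ?r x = (\<Sum>y\<in>V. ?r y)"
    using const \<open>card V = v\<close> by simp
  also have "\<dots> = (\<Sum>b\<in>#\<B>. card {y \<in> V. y \<in> b})"
    by (rule sum_size_filter_mset_swap[OF fin])
  also have "\<dots> = (\<Sum>b\<in>#\<B>. k)"
  proof (intro arg_cong[where f = sum_mset] image_mset_cong)
    fix b assume "b \<in># \<B>"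
    then have "b \<subseteq> V" "card b = k" using blk by auto
    moreover have "{y \<in> V. y \<in> b} = b" using \<open>b \<subseteq> V\<close> by auto
    ultimately show "card {y \<in> V. y \<in> b} = k" by simp
  qed
  also have "\<dots> = v * k" using \<open>size \<B> = v\<close> by simp
  finally show ?thesis using \<open>k < v\<close> by simp
qed

lemma symmetric_bibd_subset_flags:
  assumes "symmetric_bibd V \<B> v k lam" "A \<subseteq> V"
  shows "card A * k = (\<Sum>b\<in>#\<B>. card (A \<inter> b))"
proof -
  have "finite A"
    using assms finite_subset unfolding symmetric_bibd_def bibd_def by auto
  have "card A * k = (\<Sum>x\<in>A. size {#b \<in># \<B>. x \<in> b#})"
    using symmetric_bibd_replication[OF assms(1)] assms(2) by (simp add: subset_iff)
  also have "\<dots> = (\<Sum>b\<in>#\<B>. card (A \<inter> b))"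
    using sum_size_filter_mset_swap[OF \<open>finite A\<close>] by (simp add: Int_def)
  finally show ?thesis .
qed

text \<open>Ordered pairs from \<open>A\<close> are counted with the diagonal included, so that a
  block contributes a perfect square. The diagonal pairs are flags, which explains the summand
  \<open>card A * k\<close>.\<close>

lemma symmetric_bibd_subset_pairs:
  assumes "symmetric_bibd V \<B> v k lam" "A \<subseteq> V"
  shows "card A * (card A - 1) * lam + card A * k = (\<Sum>b\<in>#\<B>. (card (A \<inter> b))\<^sup>2)"
proof -
  let ?P = "\<lambda>p b. fst p \<in> b \<and> snd p \<in> b"
  have bibd: "bibd V \<B> v k lam"
    using assms(1) unfolding symmetric_bibd_def by auto
  then have fin: "finite A"
    using assms(2) finite_subset unfolding bibd_def by auto
  have row: "(\<Sum>y\<in>A. size {#b \<in># \<B>. x \<in> b \<and> y \<in> b#}) = (card A - 1) * lam + k"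
    if "x \<in> A" for x
  proof -
    have "size {#b \<in># \<B>. x \<in> b \<and> y \<in> b#} = lam" if "y \<in> A - {x}" for y
    proof -
      have "x \<in> V" "y \<in> V" "x \<noteq> y" using assms(2) \<open>x \<in> A\<close> that by auto
      then show ?thesis using bibd unfolding bibd_def by metis
    qed
    then have "(\<Sum>y\<in>A - {x}. size {#b \<in># \<B>. x \<in> b \<and> y \<in> b#}) = (\<Sum>y\<in>A - {x}. lam)"
      by (rule sum.cong[OF refl])
    moreover have "size {#b \<in># \<B>. x \<in> b#} = k"
      using symmetric_bibd_replication[OF assms(1)] assms(2) that by auto
    ultimately show ?thesis
      using fin that by (simp add: sum.remove card_Diff_singleton)
  qed
  have "card A * (card A - 1) * lam + card A * k
      = (\<Sum>x\<in>A. \<Sum>y\<in>A. size {#b \<in># \<B>. x \<in> b \<and> y \<in> b#})"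
    by (simp add: row algebra_simps)
  \<comment> \<open>The double sum is turned into one over pairs so that a single application of the
    swap lemma suffices.\<close>
  also have "\<dots> = (\<Sum>p\<in>A \<times> A. size {#b \<in># \<B>. ?P p b#})"
    by (simp add: sum.cartesian_product case_prod_beta)
  also have "\<dots> = (\<Sum>b\<in>#\<B>. card {p \<in> A \<times> A. ?P p b})"
    using fin by (intro sum_size_filter_mset_swap) simp
  also have "\<dots> = (\<Sum>b\<in>#\<B>. (card (A \<inter> b))\<^sup>2)"
  proof (intro arg_cong[where f = sum_mset] image_mset_cong)
    fix b
    have "{p \<in> A \<times> A. ?P p b} = (A \<inter> b) \<times> (A \<inter> b)" by auto
    then show "card {p \<in> A \<times> A. ?P p b} = (card (A \<inter> b))\<^sup>2"
      by (simp add: card_cartesian_product power2_eq_square)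
  qed
  finally show ?thesis .
qed

theorem theorem3p11:
  fixes V :: "'a set" and \<B> :: "'a set multiset" and v k lam l :: nat
    and C :: "'c set" and f :: "'a \<Rightarrow> 'c"
  assumes "symmetric_bibd V \<B> v k lam"
    and "zero_ULSE_colouring V \<B> k C l f"
  shows "real lam = real k * ((real l - 1)^2 - real k) / (real l - 1)^2
       \<and> (\<forall>c\<in>C. real (size {#b \<in># \<B>. \<forall>x\<in>b. f x \<noteq> c#}) = real v / real l)"
proof -
  define m where "m = k div (l - 1)"
  define cls where "cls c = {x \<in> V. f x = c}" for c
  define w where "w c = size {#b \<in># \<B>. c \<in> f ` b#}" for c
  have bibd: "bibd V \<B> v k lam" and size: "size \<B> = v"
    using assms(1) unfolding symmetric_bibd_def by auto
  then have k2: "2 \<le> k" and kv: "k < v" and lam: "0 < lam" and fin: "finite V"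
    and cardV: "card V = v" and blk: "\<And>b. b \<in># \<B> \<Longrightarrow> b \<subseteq> V"
    unfolding bibd_def by auto
  have dvd: "(l - 1) dvd k" and C: "finite C" "card C = l" "f ` V = C"
    and cnt: "\<And>b c. b \<in># \<B> \<Longrightarrow> c \<in> C \<Longrightarrow> c \<in> f ` b \<Longrightarrow> card {x \<in> b. f x = c} = m"
    using assms(2) unfolding zero_ULSE_colouring_def colouring_def m_def by auto
  \<comment> \<open>Otherwise the truncated \<open>l - 1\<close> is 0, and 0 divides only 0, whereas
    \<open>k\<close> is at least 2.\<close>
  have l2: "2 \<le> l"
    using dvd k2 by (cases "l - 1 = 0") auto
  have km: "k = (l - 1) * m"
    using dvd unfolding m_def by simp
  have km': "real k = (real l - 1) * real m"
    using km l2 by (simp add: of_nat_diff)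
  have m0: "0 < m"
    using km k2 by (cases m) auto
  have meet: "card (cls c \<inter> b) = (if c \<in> f ` b then m else 0)" if "b \<in># \<B>" "c \<in> C" for b c
  proof -
    have "cls c \<inter> b = {x \<in> b. f x = c}"
      using blk[OF that(1)] unfolding cls_def by auto
    moreover have "card {x \<in> b. f x = c} = 0" if "c \<notin> f ` b"
    proof -
      have "{x \<in> b. f x = c} = {}" using that by auto
      then show ?thesis by (simp only: card.empty)
    qed
    ultimately show ?thesis
      using cnt[OF that] by (simp only: split: if_split) blast
  qed
  have cls_sub: "cls c \<subseteq> V" for c
    unfolding cls_def by auto
  have cls_pos: "0 < card (cls c)" if "c \<in> C" for c
    using that C(3) fin unfolding cls_def by (auto simp: card_gt_0_iff)
  have flags: "card (cls c) * k = w c * m" if "c \<in> C" for c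
  proof -
    have "card (cls c) * k = (\<Sum>b\<in>#\<B>. card (cls c \<inter> b))"
      by (rule symmetric_bibd_subset_flags[OF assms(1) cls_sub])
    also have "\<dots> = (\<Sum>b\<in>#\<B>. if c \<in> f ` b then m else 0)"
      using that by (intro arg_cong[where f = sum_mset] image_mset_cong meet)
    finally show ?thesis by (simp only: sum_mset_if_const w_def)
  qed
  have pairs: "card (cls c) * (card (cls c) - 1) * lam + card (cls c) * k = w c * m\<^sup>2"
    if "c \<in> C" for c
  proof -
    have "card (cls c) * (card (cls c) - 1) * lam + card (cls c) * k
        = (\<Sum>b\<in>#\<B>. (card (cls c \<inter> b))\<^sup>2)"
      by (rule symmetric_bibd_subset_pairs[OF assms(1) cls_sub])
    also have "\<dots> = (\<Sum>b\<in>#\<B>. if c \<in> f ` b then m\<^sup>2 else 0)"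
      using that by (intro arg_cong[where f = sum_mset] image_mset_cong) (simp add: meet)
    finally show ?thesis by (simp only: sum_mset_if_const w_def)
  qed
  have w: "w c = card (cls c) * (l - 1)" if "c \<in> C" for c
    using flags[OF that] m0 by (simp add: km)
  \<comment> \<open>Here \<open>flags\<close> replaces one factor \<open>w c * m\<close> in
    \<open>pairs\<close>, and the nonzero class size cancels. Keeping \<open>k\<close> on the left
    avoids the natural subtraction \<open>m - 1\<close>.\<close>
  have class_size: "(card (cls c) - 1) * lam + k = k * m" if "c \<in> C" for c
  proof -
    have "card (cls c) * ((card (cls c) - 1) * lam + k) = w c * m\<^sup>2"
      using pairs[OF that] by (simp add: algebra_simps)
    also have "\<dots> = card (cls c) * (k * m)"
      using flags[OF that] by (simp add: power2_eq_square algebra_simps)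
    finally show ?thesis using cls_pos[OF that] by simp
  qed
  have class_eq: "v = l * card (cls c)" if "c \<in> C" for c
  proof -
    \<comment> \<open>The right-hand side of \<open>class_size\<close> does not depend on the
      colour. Since \<open>lam\<close> is positive and classes are nonempty, the truncated
      differences determine the sizes.\<close>
    have eq: "card (cls d) = card (cls c)" if "d \<in> C" for d
    proof -
      have "(card (cls d) - 1) * lam = (card (cls c) - 1) * lam"
        using class_size[OF \<open>c \<in> C\<close>] class_size[OF \<open>d \<in> C\<close>] by linarith
      then show ?thesis
        using lam cls_pos[OF \<open>c \<in> C\<close>] cls_pos[OF \<open>d \<in> C\<close>] by simp
    qed
    \<comment> \<open>The classes are the fibres of \<open>f\<close>, so they partition
      \<open>V\<close>.\<close>
    have "v = (\<Sum>d\<in>C. card (cls d))"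
      using sum.group[OF fin C(1), of f "\<lambda>_. 1::nat"] C(3) cardV by (simp add: cls_def)
    then show ?thesis using eq C(2) by simp
  qed
  have missed: "real (size {#b \<in># \<B>. \<forall>x\<in>b. f x \<noteq> c#}) = real v / real l" if "c \<in> C" for c
  proof -
    have "size \<B> = w c + size {#b \<in># \<B>. c \<notin> f ` b#}"
      unfolding w_def by (metis multiset_partition size_union)
    moreover have "{#b \<in># \<B>. c \<notin> f ` b#} = {#b \<in># \<B>. \<forall>x\<in>b. f x \<noteq> c#}"
      by (intro filter_mset_cong) auto
    moreover have "v = w c + card (cls c)"
      using class_eq[OF that] w[OF that] l2 by (cases l) auto
    ultimately have "size {#b \<in># \<B>. \<forall>x\<in>b. f x \<noteq> c#} = card (cls c)"
      using size by simp
    then show ?thesis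
      using class_eq[OF that] l2 by simp
  qed
  obtain c where c: "c \<in> C"
    using C(2) l2 by fastforce
  define n where "n = card (cls c)"
  obtain x where "x \<in> V" using c C(3) by auto
  then have "k * (k - 1) = lam * (v - 1)"
    using bibd_replication[OF bibd] symmetric_bibd_replication[OF assms(1)] by metis
  then have "real (k * (k - 1)) = real (lam * (v - 1))" by simp
  then have E1: "real k * (real k - 1) = real lam * (real v - 1)"
    using k2 kv by (simp add: of_nat_diff)
  have "real ((n - 1) * lam + k) = real (k * m)"
    using class_size[OF c] unfolding n_def by simp
  then have E2: "(real n - 1) * real lam + real k = real k * real m"
    using cls_pos[OF c] unfolding n_def by (simp add: of_nat_diff)
  have E3: "real v = real l * real n"
    using class_eq[OF c] unfolding n_def by simp
  \<comment> \<open>With \<open>v = l * n\<close>, the factor \<open>v - 1\<close> in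
    \<open>E1\<close> splits as \<open>l * (n - 1) + (l - 1)\<close>.\<close>
  have "(real l - 1) * real lam = real k * (real k - 1) - real l * ((real n - 1) * real lam)"
    unfolding E1 E3 by (simp add: algebra_simps)
  also have "(real n - 1) * real lam = real k * (real m - 1)"
    using E2 by (simp add: algebra_simps)
  \<comment> \<open>Substituting \<open>k = (l - 1) * m\<close> gives
    \<open>k - 1 - l * (m - 1) = l - 1 - m\<close>, while
    \<open>k * m = (l - 1) * m\<^sup>2\<close>; hence the common factor \<open>l - 1\<close>,
    cancelled next.\<close>
  also have "real k * (real k - 1) - real l * (real k * (real m - 1))
      = (real l - 1) * (real k - (real m)\<^sup>2)"
    unfolding km' by (simp add: algebra_simps power2_eq_square)
  finally have "real lam = real k - (real m)\<^sup>2"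
    using l2 by simp
  also have "\<dots> = real k * ((real l - 1)^2 - real k) / (real l - 1)^2"
  proof -
    \<comment> \<open>Both sides agree because
      \<open>k\<^sup>2 = (l - 1)\<^sup>2 * m\<^sup>2\<close>.\<close>
    have "real k * ((real l - 1)^2 - real k) = (real k - (real m)\<^sup>2) * (real l - 1)^2"
      unfolding km' by (simp add: algebra_simps power2_eq_square)
    then show ?thesis using l2 by simp
  qed
  finally show ?thesis
    using missed by blast
qed

end
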